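(* Let $\gamma\in\mathbb{H}$ and let $X_1,X_2,\dots$ be i.i.d. Cauchy random variables with complex parameter $\gamma$. For $p\in[-1,0)$ and $\alpha\in\overline{\mathbb{H}}$ let $f(x)=(x+\alpha)^p$ and $M^f_n=\left(\frac1n\sum_{j=1}^n (X_j+\alpha)^p\right)^{1/p}-\alpha$. Then: (i) Let $n=2$, $-1\le p<0$ and $\alpha\in\overline{\mathbb{H}}$. Then $M^f_n\notin L^2$. (ii) Let $n=3$, $p=-1$ and $\alpha\in\overline{\mathbb{H}}$. Then $M^f_n\notin L^2$. (iii) Let $n\ge3$, $-1<p<0$ and $\alpha\in\overline{\mathbb{H}}$. Then $M^f_n\in L^2$. (iv) Let $n\ge4$, $p=-1$ and $\alpha\in\mathbb{H}$. Then $M^f_n\in L^2$.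
   Context: $\mathbb{H}=\{z\in\mathbb{C}:\mathrm{Im}(z)>0\}$ and $\overline{\mathbb{H}}=\{z\in\mathbb{C}:\mathrm{Im}(z)\ge0\}$. The Cauchy distribution with complex parameter $\gamma=\mu+i\sigma$, $\mu\in\mathbb{R}$, $\sigma>0$, has density $p_\gamma(x)=\frac{\sigma}{\pi}\frac{1}{(x-\mu)^2+\sigma^2}$ on $\mathbb{R}$. Complex powers use the principal branch: $z^q=\exp(q\log z)$ with $\log z=\log r+i\theta$ for $z=r e^{i\theta}$, $r>0$, $\theta\in(-\pi,\pi]$. $Y\in L^2$ means $E[|Y|^2]<+\infty$. $M_n^f$ is almost surely well defined. *)

theory Defs
  imports "HOL-Probability.Probability"
begin

definition cauchy_density :: "complex \<Rightarrow> real \<Rightarrow> real" where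
  "cauchy_density \<gamma> x = Im \<gamma> / pi * (1 / ((x - Re \<gamma>)\<^sup>2 + (Im \<gamma>)\<^sup>2))"

text \<open>
  The quasi-arithmetic mean of \<open>X 1, \<dots>, X n\<close> with generator \<open>f x = (x + \<alpha>) powr p\<close>.
  The complex \<open>powr\<close> is the principal branch (imaginary part of \<open>Ln\<close> in \<open>(-pi, pi]\<close>);
  \<open>0 powr q = 0\<close> is a totalization that only matters on a null set.
\<close>

definition power_mean :: "(nat \<Rightarrow> 'a \<Rightarrow> real) \<Rightarrow> real \<Rightarrow> complex \<Rightarrow> nat \<Rightarrow> 'a \<Rightarrow> complex" where
  "power_mean X p \<alpha> n \<omega> =
     (1 / of_nat n * (\<Sum>j=1..n. (complex_of_real (X j \<omega>) + \<alpha>) powr complex_of_real p))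
       powr complex_of_real (1 / p) - \<alpha>"

text \<open>
  \<open>E[|Y|\<^sup>2] < \<infinity>\<close> as a nonnegative integral, so that the negation says that the
  expectation is infinite. (With \<open>integrable\<close>, a non-measurable \<open>Y\<close> would also satisfy
  the negation.)
\<close>

definition in_L2 :: "'a measure \<Rightarrow> ('a \<Rightarrow> complex) \<Rightarrow> bool" where
  "in_L2 M Y \<longleftrightarrow> (\<integral>\<^sup>+ \<omega>. ennreal ((cmod (Y \<omega>))\<^sup>2) \<partial>M) < \<infinity>"

end

theory Submission
  imports Defs
begin

text \<open>
  Write \<open>q = -p\<close> and \<open>S\<close> for the sum of \<open>(X j + \<alpha>) powr (-q)\<close>. Up to the bounded shift \<open>\<alpha>\<close>
  and a constant, the squared norm of the power mean is \<open>|S|\<close> to the power \<open>-2/q\<close>; so the question is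
  how likely it is that \<open>S\<close> is small, given that the Cauchy density decays like \<open>1/x^2\<close>.

  If \<open>q < 1\<close>, all summands lie in a convex sector that is narrower than a half-plane, so they cannot
  cancel (\<open>norm_sum_powr_ge\<close>). The mean is then large only if every \<open>|X j + \<alpha>|\<close> is large, and its
  square is at most a constant times the square of the geometric mean of the \<open>|X j + \<alpha>|\<close>. By
  independence the expectation factors into moments of order \<open>2/n\<close>, which are finite for \<open>n \<ge> 3\<close>
  (\<open>nn_integral_mean_powr_finite\<close>).

  If \<open>q = 1\<close> and \<open>Im \<alpha> > 0\<close>, the real part of \<open>S\<close> may vanish by cancellation, but the imaginary
  parts of the summands all have the same sign. Integrating over one observation is a Moebius change of
  variables that leads back to a Cauchy density, and it turns \<open>1/|S|^2\<close> into the reciprocal of the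
  imaginary part of the remaining sum (\<open>cauchy_inverse_shift_bound\<close>). This reciprocal is again bounded
  through a geometric mean, of the remaining \<open>n - 1\<close> observations, so \<open>n \<ge> 4\<close> is enough.

  The two divergence results exhibit explicit boxes with unit sides. For \<open>n = 2\<close> both
  observations are of the order of \<open>a\<close>: there are about \<open>a\<close> boxes for each \<open>a\<close>, of probability about
  \<open>1/a^4\<close>, on which the squared mean is at least of order \<open>a^2\<close>. For \<open>n = 3\<close> and \<open>q = 1\<close>, the third
  observation is negative and nearly cancels the reciprocals of the other two
  (\<open>reciprocal_sum_bound\<close>); then the probability is about \<open>1/a^6\<close> and the squared mean is at least
  of order \<open>a^4\<close>. In both cases the level \<open>a\<close> contributes a constant times \<open>1/a\<close>, and the harmonic series
  diverges (\<open>not_in_L2_if_dyadic_boxes\<close>).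
\<close>

section \<open>The Cauchy density and its integrals\<close>

lemma one_plus_abs_sq_le:
  fixes x m s :: real
  assumes "s > 0"
  shows "(1 + \<bar>x\<bar>)\<^sup>2 \<le> (2 + 2 * (1 + \<bar>m\<bar>)\<^sup>2 / s\<^sup>2) * ((x - m)\<^sup>2 + s\<^sup>2)"
proof -
  have "1 + \<bar>x\<bar> \<le> \<bar>x - m\<bar> + (1 + \<bar>m\<bar>)" by linarith
  hence "(1 + \<bar>x\<bar>)\<^sup>2 \<le> (\<bar>x - m\<bar> + (1 + \<bar>m\<bar>))\<^sup>2" by (intro power_mono) auto
  also have "\<dots> \<le> 2 * (x - m)\<^sup>2 + 2 * (1 + \<bar>m\<bar>)\<^sup>2"
    using sum_squares_bound[of "\<bar>x - m\<bar>" "1 + \<bar>m\<bar>"] by (simp add: power2_sum)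
  also have "\<dots> \<le> (2 + 2 * (1 + \<bar>m\<bar>)\<^sup>2 / s\<^sup>2) * ((x - m)\<^sup>2 + s\<^sup>2)"
    using assms by (simp add: field_simps)
  finally show ?thesis .
qed

lemma cauchy_density_upper_bound:
  assumes "Im \<gamma> > 0"
  shows "\<exists>C>0. \<forall>x. cauchy_density \<gamma> x \<le> C / (1 + \<bar>x\<bar>)\<^sup>2"
proof (intro exI conjI allI)
  let ?m = "Re \<gamma>" and ?s = "Im \<gamma>"
  let ?K = "2 + 2 * (1 + \<bar>?m\<bar>)\<^sup>2 / ?s\<^sup>2"
  have K: "?K > 0" by (intro add_pos_nonneg) auto
  show "?s / pi * ?K > 0" using assms K by (intro mult_pos_pos) auto
  fix x
  have pos: "(x - ?m)\<^sup>2 + ?s\<^sup>2 > 0" using assms by (intro add_nonneg_pos) auto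
  have "1 / ((x - ?m)\<^sup>2 + ?s\<^sup>2) \<le> ?K / (1 + \<bar>x\<bar>)\<^sup>2"
    using one_plus_abs_sq_le[OF assms, of x ?m] pos by (simp add: divide_simps mult.commute)
  hence "?s / pi * (1 / ((x - ?m)\<^sup>2 + ?s\<^sup>2)) \<le> ?s / pi * (?K / (1 + \<bar>x\<bar>)\<^sup>2)"
    using assms by (intro mult_left_mono) auto
  thus "cauchy_density \<gamma> x \<le> ?s / pi * ?K / (1 + \<bar>x\<bar>)\<^sup>2"
    by (simp add: cauchy_density_def)
qed

lemma cauchy_density_nonneg: "Im \<gamma> > 0 \<Longrightarrow> cauchy_density \<gamma> x \<ge> 0"
  by (simp add: cauchy_density_def)

text \<open>
  The floor of \<open>x + r\<close> is a scale on which disjoint unit boxes can be indexed by integers; the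
  shift \<open>r\<close> will be the real part of \<open>\<alpha>\<close>.
\<close>

lemma cauchy_density_lower_bound:
  assumes "Im \<gamma> > 0"
  shows "\<exists>c>0. \<forall>(k::int) x. \<lfloor>x + r\<rfloor> = k \<longrightarrow> c / (1 + (real_of_int k)\<^sup>2) \<le> cauchy_density \<gamma> x"
proof (intro exI conjI allI impI)
  let ?m = "Re \<gamma>" and ?s = "Im \<gamma>"
  define K where "K = 4 + 2 * (?m + r)\<^sup>2 + ?s\<^sup>2"
  have K: "K > 0" unfolding K_def by (intro add_pos_nonneg) auto
  show "?s / pi / K > 0" using assms K by simp
  fix k :: int and x assume "\<lfloor>x + r\<rfloor> = k"
  hence "\<bar>x + r\<bar> \<le> \<bar>real_of_int k\<bar> + 1" by linarith
  hence "(x + r)\<^sup>2 \<le> (\<bar>real_of_int k\<bar> + 1)\<^sup>2" by (metis abs_ge_zero power2_abs power_mono)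
  also have "\<dots> \<le> 2 * (real_of_int k)\<^sup>2 + 2"
    using sum_squares_bound[of "\<bar>real_of_int k\<bar>" 1] by (simp add: power2_sum)
  finally have 1: "(x + r)\<^sup>2 \<le> 2 * (real_of_int k)\<^sup>2 + 2" .
  have "(x - ?m)\<^sup>2 = ((x + r) - (?m + r))\<^sup>2" by simp
  also have "\<dots> = 2 * (x + r)\<^sup>2 + 2 * (?m + r)\<^sup>2 - ((x + r) + (?m + r))\<^sup>2"
    by (simp add: power2_eq_square algebra_simps)
  also have "\<dots> \<le> 2 * (x + r)\<^sup>2 + 2 * (?m + r)\<^sup>2" by simp
  also have "\<dots> \<le> 4 * (real_of_int k)\<^sup>2 + 4 + 2 * (?m + r)\<^sup>2" using 1 by simp
  finally have "(x - ?m)\<^sup>2 + ?s\<^sup>2 \<le> K + 4 * (real_of_int k)\<^sup>2" by (simp add: K_def)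
  also have "\<dots> \<le> K * (1 + (real_of_int k)\<^sup>2)" by (simp add: K_def algebra_simps)
  finally have 2: "(x - ?m)\<^sup>2 + ?s\<^sup>2 \<le> K * (1 + (real_of_int k)\<^sup>2)" .
  have pos: "(x - ?m)\<^sup>2 + ?s\<^sup>2 > 0" using assms by (intro add_nonneg_pos) auto
  have "1 / (K * (1 + (real_of_int k)\<^sup>2)) \<le> 1 / ((x - ?m)\<^sup>2 + ?s\<^sup>2)"
    using 2 pos by (intro divide_left_mono) auto
  hence "?s / pi * (1 / (K * (1 + (real_of_int k)\<^sup>2))) \<le> ?s / pi * (1 / ((x - ?m)\<^sup>2 + ?s\<^sup>2))"
    using assms by (intro mult_left_mono) auto
  thus "?s / pi / K / (1 + (real_of_int k)\<^sup>2) \<le> cauchy_density \<gamma> x"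
    by (simp add: cauchy_density_def)
qed

text \<open>
  Up to a constant factor, this says that a Cauchy density with location \<open>- a\<close> and scale \<open>b\<close>
  has total mass one; the substitution \<open>x = b t - a\<close> reduces it to the arctangent integral.
\<close>

lemma nn_integral_inverse_quadratic:
  fixes a b :: real
  assumes "b > 0"
  shows "(\<integral>\<^sup>+x. ennreal (1 / ((x + a)\<^sup>2 + b\<^sup>2)) \<partial>lborel) = ennreal (pi / b)"
proof -
  have int: "integrable lborel (\<lambda>x::real. inverse (1 + x\<^sup>2))"
    using integrable_inverse_1_plus_square by (simp add: set_integrable_def)
  have val: "(\<integral>x. inverse (1 + x\<^sup>2) \<partial>lborel) = pi"
    using LBINT_inverse_1_plus_square
    by (simp add: interval_lebesgue_integral_def set_lebesgue_integral_def)
  have std: "(\<integral>\<^sup>+x. ennreal (inverse (1 + x\<^sup>2)) \<partial>lborel) = ennreal pi"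
    using nn_integral_eq_integral[OF int] val by simp
  have "(\<integral>\<^sup>+x. ennreal (1 / ((x + a)\<^sup>2 + b\<^sup>2)) \<partial>lborel)
      = ennreal b * (\<integral>\<^sup>+x. ennreal (1 / ((- a + b * x + a)\<^sup>2 + b\<^sup>2)) \<partial>lborel)"
    using nn_integral_real_affine[of "\<lambda>x. ennreal (1 / ((x + a)\<^sup>2 + b\<^sup>2))" b "-a"] assms by simp
  also have "\<dots> = ennreal b * (\<integral>\<^sup>+x. ennreal (1 / b\<^sup>2) * ennreal (inverse (1 + x\<^sup>2)) \<partial>lborel)"
  proof -
    have "1 / ((- a + b * x + a)\<^sup>2 + b\<^sup>2) = 1 / b\<^sup>2 * inverse (1 + x\<^sup>2)" for x
    proof -
      have "(- a + b * x + a)\<^sup>2 + b\<^sup>2 = b\<^sup>2 * (1 + x\<^sup>2)" by (simp add: algebra_simps power2_eq_square)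
      thus ?thesis by (simp add: field_simps)
    qed
    thus ?thesis by (simp only:) (subst ennreal_mult, auto)
  qed
  also have "\<dots> = ennreal b * (ennreal (1 / b\<^sup>2) * ennreal pi)"
    by (subst nn_integral_cmult) (auto simp: std)
  also have "\<dots> = ennreal (pi / b)"
    using assms by (simp add: ennreal_mult[symmetric] power2_eq_square)
  finally show ?thesis .
qed

lemma nn_integral_one_plus_abs_powr_finite:
  assumes "u < -1"
  shows "(\<integral>\<^sup>+x. ennreal ((1 + \<bar>x::real\<bar>) powr u) \<partial>lborel) < \<infinity>"
proof -
  let ?F = "\<lambda>x::real. (1 + x) powr (u + 1) / (u + 1)"
  let ?h = "\<lambda>x::real. ennreal ((1 + x) powr u) * indicator {0..} x"
  have half: "(\<integral>\<^sup>+x. ?h x \<partial>lborel) = ennreal (0 - ?F 0)"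
  proof (rule nn_integral_FTC_atLeast)
    fix x :: real assume "0 \<le> x"
    thus "(?F has_real_derivative (1 + x) powr u) (at x)"
      using assms by (auto intro!: derivative_eq_intros)
  next
    show "(?F \<longlongrightarrow> 0) at_top"
    proof -
      have "((\<lambda>x::real. (1 + x) powr (u + 1)) \<longlongrightarrow> 0) at_top"
        using assms by (intro tendsto_neg_powr filterlim_tendsto_add_at_top[OF tendsto_const] filterlim_ident) auto
      thus ?thesis using tendsto_divide[OF _ tendsto_const, of _ 0 at_top "u + 1"] assms by force
    qed
  qed auto
  have "(\<integral>\<^sup>+x. ennreal ((1 + \<bar>x::real\<bar>) powr u) \<partial>lborel) \<le> (\<integral>\<^sup>+x. ?h x + ?h (- x) \<partial>lborel)"
    by (intro nn_integral_mono) (auto split: split_indicator)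
  also have "\<dots> = (\<integral>\<^sup>+x. ?h x \<partial>lborel) + (\<integral>\<^sup>+x. ?h (- x) \<partial>lborel)"
    by (intro nn_integral_add) auto
  also have "(\<integral>\<^sup>+x. ?h (- x) \<partial>lborel) = (\<integral>\<^sup>+x. ?h x \<partial>lborel)"
    by (subst nn_integral_real_affine[of ?h "-1" 0]) auto
  finally show ?thesis unfolding half by (auto simp: less_top[symmetric] top_unique)
qed

lemma norm_real_add_le: "cmod (complex_of_real x + \<alpha>) \<le> (1 + cmod \<alpha>) * (1 + \<bar>x\<bar>)"
proof -
  have "cmod (complex_of_real x + \<alpha>) \<le> \<bar>x\<bar> + cmod \<alpha>" using norm_triangle_ineq[of "of_real x" \<alpha>] by simp
  also have "\<dots> \<le> (1 + cmod \<alpha>) * (1 + \<bar>x\<bar>)" by (simp add: algebra_simps)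
  finally show ?thesis .
qed

lemma borel_measurable_cauchy_density [measurable]: "cauchy_density \<gamma> \<in> borel_measurable borel"
  unfolding cauchy_density_def by measurable

text \<open>
  The density is \<open>O(1/x^2)\<close>, so a moment of order \<open>s\<close> is bounded by a multiple of the integral of
  \<open>(1 + |x|)\<close> to the power \<open>s - 2\<close>, which converges for \<open>s < 1\<close>.
\<close>

lemma cauchy_moment_finite:
  assumes "Im \<gamma> > 0" "0 \<le> s" "s < 1"
  shows "(\<integral>\<^sup>+x. ennreal (cmod (complex_of_real x + \<alpha>) powr s)
           \<partial>density lborel (\<lambda>x. ennreal (cauchy_density \<gamma> x))) < \<infinity>"
proof -
  obtain C where C: "C > 0" "\<And>x. cauchy_density \<gamma> x \<le> C / (1 + \<bar>x\<bar>)\<^sup>2"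
    using cauchy_density_upper_bound[OF assms(1)] by auto
  let ?K = "C * (1 + cmod \<alpha>) powr s"
  have bound: "cauchy_density \<gamma> x * cmod (complex_of_real x + \<alpha>) powr s \<le> ?K * (1 + \<bar>x\<bar>) powr (s - 2)" for x
  proof -
    have "cauchy_density \<gamma> x * cmod (complex_of_real x + \<alpha>) powr s
        \<le> C / (1 + \<bar>x\<bar>)\<^sup>2 * ((1 + cmod \<alpha>) * (1 + \<bar>x\<bar>)) powr s"
      using C assms norm_real_add_le[of x \<alpha>]
      by (intro mult_mono powr_mono2) (auto simp: less_imp_le)
    also have "\<dots> = C / (1 + \<bar>x\<bar>) powr 2 * ((1 + cmod \<alpha>) powr s * (1 + \<bar>x\<bar>) powr s)"
      by (simp add: powr_mult)
    also have "\<dots> = ?K * (1 + \<bar>x\<bar>) powr (s - 2)" unfolding powr_diff by simp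
    finally show ?thesis .
  qed
  have "(\<integral>\<^sup>+x. ennreal (cmod (complex_of_real x + \<alpha>) powr s)
           \<partial>density lborel (\<lambda>x. ennreal (cauchy_density \<gamma> x)))
      = (\<integral>\<^sup>+x. ennreal (cauchy_density \<gamma> x * cmod (complex_of_real x + \<alpha>) powr s) \<partial>lborel)"
    by (subst nn_integral_density) (auto simp: ennreal_mult cauchy_density_nonneg assms)
  also have "\<dots> \<le> (\<integral>\<^sup>+x. ennreal ?K * ennreal ((1 + \<bar>x\<bar>) powr (s - 2)) \<partial>lborel)"
    using bound C by (intro nn_integral_mono) (auto simp: ennreal_mult[symmetric] intro!: ennreal_leI)
  also have "\<dots> = ennreal ?K * (\<integral>\<^sup>+x. ennreal ((1 + \<bar>x\<bar>) powr (s - 2)) \<partial>lborel)"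
    by (intro nn_integral_cmult) auto
  also have "\<dots> < \<infinity>"
    using nn_integral_one_plus_abs_powr_finite[of "s - 2"] assms by (auto simp: ennreal_mult_less_top)
  finally show ?thesis .
qed

text \<open>
  The key estimate for harmonic means. With \<open>\<zeta> = \<alpha> + 1/w\<close> one has
  \<open>1/(x + \<alpha>) + w = w (x + \<zeta>) / (x + \<alpha>)\<close>, so the integrand is
  \<open>|x + \<alpha>|^2 / (|w|^2 |x + \<zeta>|^2)\<close>. The factor \<open>|x + \<alpha>|^2\<close> is absorbed by the decay of the
  density, and what is left is a multiple of a Cauchy density with scale
  \<open>Im \<zeta> \<ge> - Im w / |w|^2\<close>, whose integral is \<open>pi / Im \<zeta>\<close>. The powers of \<open>|w|\<close> cancel, so that the
  bound sees only \<open>Im w\<close>.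
\<close>

lemma cauchy_inverse_shift_bound:
  assumes "Im \<gamma> > 0" "Im \<alpha> > 0"
  shows "\<exists>C>0. \<forall>w. Im w < 0 \<longrightarrow>
     (\<integral>\<^sup>+x. ennreal (1 / (cmod (inverse (complex_of_real x + \<alpha>) + w))\<^sup>2)
           \<partial>density lborel (\<lambda>x. ennreal (cauchy_density \<gamma> x))) \<le> ennreal (C / (- Im w))"
proof -
  obtain C where C: "C > 0" "\<And>x. cauchy_density \<gamma> x \<le> C / (1 + \<bar>x\<bar>)\<^sup>2"
    using cauchy_density_upper_bound[OF assms(1)] by auto
  define K where "K = C * (1 + cmod \<alpha>)\<^sup>2"
  have K: "K > 0" unfolding K_def using C(1) by (intro mult_pos_pos zero_less_power add_pos_nonneg) auto
  have main: "(\<integral>\<^sup>+x. ennreal (1 / (cmod (inverse (complex_of_real x + \<alpha>) + w))\<^sup>2)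
           \<partial>density lborel (\<lambda>x. ennreal (cauchy_density \<gamma> x))) \<le> ennreal (K * pi / (- Im w))"
    if w: "Im w < 0" for w
  proof -
    from w have w0: "w \<noteq> 0" by auto
    define \<zeta> where "\<zeta> = \<alpha> + inverse w"
    have Im\<zeta>: "Im \<zeta> = Im \<alpha> + (- Im w) / (cmod w)\<^sup>2"
      by (simp add: \<zeta>_def cmod_power2)
    have le: "(- Im w) / (cmod w)\<^sup>2 \<le> Im \<zeta>" "0 < (- Im w) / (cmod w)\<^sup>2" using assms w w0 by (auto simp: Im\<zeta> divide_neg_pos)
    hence Im\<zeta>0: "Im \<zeta> > 0" by linarith
    have bound: "cauchy_density \<gamma> x * (1 / (cmod (inverse (complex_of_real x + \<alpha>) + w))\<^sup>2)
       \<le> K / (cmod w)\<^sup>2 * (1 / ((x + Re \<zeta>)\<^sup>2 + (Im \<zeta>)\<^sup>2))" for x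
    proof -
      have nz: "complex_of_real x + \<alpha> \<noteq> 0" using assms by (auto simp: complex_eq_iff)
      have "inverse (complex_of_real x + \<alpha>) + w = w * (complex_of_real x + \<zeta>) / (complex_of_real x + \<alpha>)"
      proof -
        have "w * (complex_of_real x + \<zeta>) = w * (complex_of_real x + \<alpha>) + 1"
          using w0 by (simp add: \<zeta>_def distrib_left)
        thus ?thesis using nz by (simp add: add_divide_distrib inverse_eq_divide)
      qed
      hence "1 / (cmod (inverse (complex_of_real x + \<alpha>) + w))\<^sup>2
           = (cmod (complex_of_real x + \<alpha>))\<^sup>2 / (cmod w)\<^sup>2 * (1 / (cmod (complex_of_real x + \<zeta>))\<^sup>2)"
        by (simp add: norm_mult norm_divide power_mult_distrib power_divide)
      moreover have "(cmod (complex_of_real x + \<zeta>))\<^sup>2 = (x + Re \<zeta>)\<^sup>2 + (Im \<zeta>)\<^sup>2"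
        by (simp add: cmod_power2)
      moreover have "cauchy_density \<gamma> x * (cmod (complex_of_real x + \<alpha>))\<^sup>2 \<le> K"
      proof -
        have "cauchy_density \<gamma> x * (cmod (complex_of_real x + \<alpha>))\<^sup>2
            \<le> C / (1 + \<bar>x\<bar>)\<^sup>2 * ((1 + cmod \<alpha>) * (1 + \<bar>x\<bar>))\<^sup>2"
          using C norm_real_add_le[of x \<alpha>] by (intro mult_mono power_mono) (auto simp: less_imp_le)
        also have "\<dots> = K" unfolding K_def by (simp add: power_mult_distrib)
        finally show ?thesis .
      qed
      ultimately show ?thesis
        using mult_right_mono[of "cauchy_density \<gamma> x * (cmod (complex_of_real x + \<alpha>))\<^sup>2" K
            "1 / (cmod w)\<^sup>2 * (1 / ((x + Re \<zeta>)\<^sup>2 + (Im \<zeta>)\<^sup>2))"]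
        by (simp add: mult_ac)
    qed
    have "(\<integral>\<^sup>+x. ennreal (1 / (cmod (inverse (complex_of_real x + \<alpha>) + w))\<^sup>2)
           \<partial>density lborel (\<lambda>x. ennreal (cauchy_density \<gamma> x)))
       = (\<integral>\<^sup>+x. ennreal (cauchy_density \<gamma> x * (1 / (cmod (inverse (complex_of_real x + \<alpha>) + w))\<^sup>2)) \<partial>lborel)"
      by (subst nn_integral_density) (auto simp: ennreal_mult[symmetric] cauchy_density_nonneg assms)
    also have "\<dots> \<le> (\<integral>\<^sup>+x. ennreal (K / (cmod w)\<^sup>2) * ennreal (1 / ((x + Re \<zeta>)\<^sup>2 + (Im \<zeta>)\<^sup>2)) \<partial>lborel)"
      using bound K by (intro nn_integral_mono) (subst ennreal_mult[symmetric], auto intro!: ennreal_leI)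
    also have "\<dots> = ennreal (K / (cmod w)\<^sup>2) * ennreal (pi / Im \<zeta>)"
      by (subst nn_integral_cmult) (auto simp: nn_integral_inverse_quadratic[OF Im\<zeta>0])
    also have "\<dots> = ennreal (K / (cmod w)\<^sup>2 * (pi / Im \<zeta>))"
      using K Im\<zeta>0 by (intro ennreal_mult[symmetric]) auto
    also have "\<dots> \<le> ennreal (K / (cmod w)\<^sup>2 * (pi / ((- Im w) / (cmod w)\<^sup>2)))"
      using divide_left_mono[OF le(1) _ mult_pos_pos[OF Im\<zeta>0 le(2)], of pi] K
      by (intro ennreal_leI mult_left_mono) auto
    also have "K / (cmod w)\<^sup>2 * (pi / ((- Im w) / (cmod w)\<^sup>2)) = K * pi / (- Im w)"
      using w0 by simp
    finally show ?thesis .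
  qed
  show ?thesis using main K by (intro exI[of _ "K * pi"]) auto
qed

section \<open>Power sums\<close>

text \<open>
  The sum is at least its largest term, which belongs to the smallest \<open>z k\<close>; so the left-hand side is
  at most \<open>(z k)^2\<close>, and the square of the minimum is at most that of the geometric mean. A product
  is what independence can handle.
\<close>

lemma mean_powr_le_geometric:
  fixes z :: "'i \<Rightarrow> real"
  assumes "finite J" "J \<noteq> {}" "\<And>j. j \<in> J \<Longrightarrow> z j > 0" "q > 0"
  shows "(\<Sum>j\<in>J. z j powr (-q)) powr (-2/q) \<le> (\<Prod>j\<in>J. z j powr (2 / card J))"
proof -
  have card: "card J > 0" using assms by (simp add: card_gt_0_iff)
  obtain k where k: "k \<in> J" "\<And>j. j \<in> J \<Longrightarrow> z k \<le> z j"
    using arg_min_if_finite[OF assms(1,2), of z] by (metis not_less)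
  have zk: "z k > 0" using k assms by auto
  have "z k powr (-q) \<le> (\<Sum>j\<in>J. z j powr (-q))"
    using k assms by (intro member_le_sum) auto
  hence "(\<Sum>j\<in>J. z j powr (-q)) powr (-2/q) \<le> (z k powr (-q)) powr (-2/q)"
    using assms zk by (intro powr_mono2') auto
  also have "\<dots> = (z k powr (2 / card J)) ^ card J"
    using assms card zk by (simp add: powr_powr powr_power)
  also have "\<dots> = (\<Prod>j\<in>J. z k powr (2 / card J))" by simp
  also have "\<dots> \<le> (\<Prod>j\<in>J. z j powr (2 / card J))"
    using k zk by (intro prod_mono) (auto intro!: powr_mono2)
  finally show ?thesis .
qed

text \<open>
  If \<open>z\<close> lies in the closed upper half-plane, then \<open>z powr (-q)\<close> lies in the sector of arguments
  between \<open>- q pi\<close> and \<open>0\<close>. For \<open>q < 1\<close> this sector is narrower than a half-plane: rotated by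
  \<open>q pi / 2\<close> it becomes symmetric about the positive real axis, and every vector in it has real part
  at least \<open>cos (q pi / 2)\<close> times its norm. Hence there is no cancellation in the sum. At \<open>q = 1\<close>
  the constant degenerates to \<open>0\<close>.
\<close>

lemma norm_sum_powr_ge:
  assumes "finite J" "0 < q" "q < 1" "\<And>j. j \<in> J \<Longrightarrow> Im (z j) \<ge> 0"
  shows "cos (q * pi / 2) * (\<Sum>j\<in>J. cmod (z j) powr (-q))
           \<le> cmod (\<Sum>j\<in>J. z j powr complex_of_real (-q))"
proof -
  let ?e = "cis (q * pi / 2)"
  have rot: "cos (q * pi / 2) * cmod w powr (-q) \<le> Re (?e * w powr complex_of_real (-q))"
    if w: "Im w \<ge> 0" for w
  proof (cases "w = 0")
    case False
    define \<theta> where "\<theta> = Im (Ln w)"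
    have \<theta>: "0 \<le> \<theta>" "\<theta> \<le> pi" using w False Im_Ln_pos_le[of w] Im_Ln_le_pi[of w] by (auto simp: \<theta>_def)
    have "w powr complex_of_real (-q) = exp (complex_of_real (-q) * Ln w)" using False by (simp add: powr_def)
    also have "complex_of_real (-q) * Ln w = Complex (- q * ln (cmod w)) (- q * \<theta>)"
      using False by (simp add: complex_eq_iff \<theta>_def)
    also have "exp \<dots> = complex_of_real (cmod w powr (-q)) * cis (- q * \<theta>)"
      using False by (simp add: exp_eq_polar powr_def exp_of_real)
    finally have "?e * w powr complex_of_real (-q) = complex_of_real (cmod w powr (-q)) * (?e * cis (- q * \<theta>))"
      by simp
    hence re: "Re (?e * w powr complex_of_real (-q)) = cmod w powr (-q) * cos (q * pi / 2 + - q * \<theta>)"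
      unfolding cis_mult by simp
    have "q * pi / 2 + - q * \<theta> = q * (pi / 2 - \<theta>)" by (simp add: right_diff_distrib)
    hence "\<bar>q * pi / 2 + - q * \<theta>\<bar> = q * \<bar>pi / 2 - \<theta>\<bar>" using assms by (simp add: abs_mult)
    also have "\<dots> \<le> q * (pi / 2)"
    proof (intro mult_left_mono)
      show "\<bar>pi / 2 - \<theta>\<bar> \<le> pi / 2" using \<theta> by linarith
    qed (use assms in auto)
    finally have le: "\<bar>q * pi / 2 + - q * \<theta>\<bar> \<le> q * pi / 2" by simp
    have "q * pi / 2 \<le> pi" using assms by (simp add: divide_simps)
    hence "cos (q * pi / 2) \<le> cos \<bar>q * pi / 2 + - q * \<theta>\<bar>" by (intro cos_monotone_0_pi_le le) auto
    thus ?thesis unfolding re cos_abs_real by (simp add: mult_left_mono mult.commute)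
  qed auto
  have "cos (q * pi / 2) * (\<Sum>j\<in>J. cmod (z j) powr (-q)) \<le> (\<Sum>j\<in>J. Re (?e * z j powr complex_of_real (-q)))"
    unfolding sum_distrib_left using assms by (intro sum_mono rot) auto
  also have "\<dots> = Re (?e * (\<Sum>j\<in>J. z j powr complex_of_real (-q)))" by (simp add: sum_distrib_left)
  also have "\<dots> \<le> cmod (?e * (\<Sum>j\<in>J. z j powr complex_of_real (-q)))" by (rule complex_Re_le_cmod)
  finally show ?thesis by (simp add: norm_mult)
qed

section \<open>Criteria for square integrability\<close>

lemma norm_diff_sq_le: "(cmod (x - y))\<^sup>2 \<le> 2 * (cmod x)\<^sup>2 + 2 * (cmod y)\<^sup>2"
proof -
  have "(cmod (x - y))\<^sup>2 \<le> (cmod x + cmod y)\<^sup>2" by (intro power_mono norm_triangle_ineq4) auto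
  also have "\<dots> \<le> 2 * (cmod x)\<^sup>2 + 2 * (cmod y)\<^sup>2"
    using sum_squares_bound[of "cmod x" "cmod y"] by (simp add: power2_sum)
  finally show ?thesis .
qed

text \<open>
  The bound on the second moment splits the integral of a sum; this is applied to the measurable
  majorant \<open>G\<close>, so that \<open>Y\<close> can be any expression with complex powers.
\<close>

lemma (in prob_space) in_L2_diff_constI:
  assumes [measurable]: "G \<in> borel_measurable M" and "(\<integral>\<^sup>+\<omega>. G \<omega> \<partial>M) < \<infinity>"
    and "\<And>\<omega>. ennreal ((cmod (Y \<omega>))\<^sup>2) \<le> G \<omega>"
  shows "in_L2 M (\<lambda>\<omega>. Y \<omega> - \<alpha>)"
proof -
  have "(\<integral>\<^sup>+\<omega>. ennreal ((cmod (Y \<omega> - \<alpha>))\<^sup>2) \<partial>M) \<le> (\<integral>\<^sup>+\<omega>. 2 * G \<omega> + ennreal (2 * (cmod \<alpha>)\<^sup>2) \<partial>M)"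
  proof (intro nn_integral_mono)
    fix \<omega>
    have "ennreal ((cmod (Y \<omega> - \<alpha>))\<^sup>2) \<le> ennreal (2 * (cmod (Y \<omega>))\<^sup>2 + 2 * (cmod \<alpha>)\<^sup>2)"
      by (intro ennreal_leI norm_diff_sq_le)
    also have "\<dots> = 2 * ennreal ((cmod (Y \<omega>))\<^sup>2) + ennreal (2 * (cmod \<alpha>)\<^sup>2)"
      by (simp add: ennreal_mult)
    also have "\<dots> \<le> 2 * G \<omega> + ennreal (2 * (cmod \<alpha>)\<^sup>2)"
      using assms(3)[of \<omega>] by (intro add_mono mult_left_mono) auto
    finally show "ennreal ((cmod (Y \<omega> - \<alpha>))\<^sup>2) \<le> 2 * G \<omega> + ennreal (2 * (cmod \<alpha>)\<^sup>2)" .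
  qed
  also have "\<dots> = 2 * (\<integral>\<^sup>+\<omega>. G \<omega> \<partial>M) + ennreal (2 * (cmod \<alpha>)\<^sup>2)"
    by (simp add: nn_integral_add nn_integral_cmult emeasure_space_1)
  also have "\<dots> < \<infinity>" using assms(2) by (simp add: ennreal_mult_less_top)
  finally show ?thesis by (simp add: in_L2_def)
qed

text \<open>
  If the disjoint events \<open>E a b\<close> with \<open>N \<le> a \<le> b < 2 a\<close> each contribute at least \<open>\<kappa> / a^2\<close> to the
  second moment, then the \<open>a\<close> events with the same first index contribute \<open>\<kappa> / a\<close>, and the harmonic
  series diverges.
\<close>

lemma (in prob_space) not_in_L2_if_dyadic_boxes:
  fixes E :: "nat \<Rightarrow> nat \<Rightarrow> 'a set" and v :: "nat \<Rightarrow> real"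
  assumes "\<kappa> > 0"
    and ev: "\<And>a b. E a b \<in> events"
    and disj: "\<And>a b a' b' \<omega>. \<omega> \<in> E a b \<Longrightarrow> \<omega> \<in> E a' b' \<Longrightarrow> a = a' \<and> b = b'"
    and v: "\<And>a. v a \<ge> 0"
    and lower: "\<And>a b \<omega>. N \<le> a \<Longrightarrow> a \<le> b \<Longrightarrow> b < 2 * a \<Longrightarrow> \<omega> \<in> E a b \<Longrightarrow> v a \<le> (cmod (Y \<omega>))\<^sup>2"
    and prob: "\<And>a b. N \<le> a \<Longrightarrow> a \<le> b \<Longrightarrow> b < 2 * a \<Longrightarrow> \<kappa> / (real a)\<^sup>2 \<le> v a * prob (E a b)"
  shows "\<not> in_L2 M Y"
proof
  assume "in_L2 M Y"
  then obtain I where I: "(\<integral>\<^sup>+\<omega>. ennreal ((cmod (Y \<omega>))\<^sup>2) \<partial>M) = ennreal I" "I \<ge> 0"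
    unfolding in_L2_def by (cases "\<integral>\<^sup>+\<omega>. ennreal ((cmod (Y \<omega>))\<^sup>2) \<partial>M") auto
  have bound: "(\<Sum>i<m. inverse (real (i + N))) \<le> I / \<kappa>" for m
  proof -
    define F where "F = Sigma {N..<N + m} (\<lambda>a. {a..<2 * a})"
    have finF: "finite F" by (simp add: F_def)
    have "(\<Sum>p\<in>F. ennreal (v (fst p)) * emeasure M (E (fst p) (snd p)))
        = (\<integral>\<^sup>+\<omega>. (\<Sum>p\<in>F. ennreal (v (fst p)) * indicator (E (fst p) (snd p)) \<omega>) \<partial>M)"
      using ev by (subst nn_integral_sum) (auto simp: nn_integral_cmult_indicator)
    also have "\<dots> \<le> (\<integral>\<^sup>+\<omega>. ennreal ((cmod (Y \<omega>))\<^sup>2) \<partial>M)"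
    proof (intro nn_integral_mono)
      fix \<omega>
      show "(\<Sum>p\<in>F. ennreal (v (fst p)) * indicator (E (fst p) (snd p)) \<omega>) \<le> ennreal ((cmod (Y \<omega>))\<^sup>2)"
      proof (cases "\<exists>p\<in>F. \<omega> \<in> E (fst p) (snd p)")
        case True
        then obtain p where p: "p \<in> F" "\<omega> \<in> E (fst p) (snd p)" by auto
        have "(\<Sum>p'\<in>F. ennreal (v (fst p')) * indicator (E (fst p') (snd p')) \<omega>)
            = (\<Sum>p'\<in>F. if p' = p then ennreal (v (fst p)) else 0)"
          using disj p(2) by (intro sum.cong) (auto simp: indicator_def prod_eq_iff)
        also have "\<dots> = ennreal (v (fst p))" using finF p by simp
        also have "\<dots> \<le> ennreal ((cmod (Y \<omega>))\<^sup>2)"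
          using p by (intro ennreal_leI lower[of _ "snd p"]) (auto simp: F_def)
        finally show ?thesis .
      next
        case False
        thus ?thesis by (simp add: sum.neutral)
      qed
    qed
    finally have "ennreal (\<Sum>p\<in>F. v (fst p) * prob (E (fst p) (snd p))) \<le> ennreal I"
      using v I by (simp add: emeasure_eq_measure ennreal_mult[symmetric] sum_ennreal)
    hence "(\<Sum>p\<in>F. v (fst p) * prob (E (fst p) (snd p))) \<le> I" using I by (simp add: ennreal_le_iff)
    moreover have "(\<Sum>p\<in>F. \<kappa> / (real (fst p))\<^sup>2) \<le> (\<Sum>p\<in>F. v (fst p) * prob (E (fst p) (snd p)))"
      by (intro sum_mono prob) (auto simp: F_def)
    moreover have "(\<Sum>p\<in>F. \<kappa> / (real (fst p))\<^sup>2) = (\<Sum>a\<in>{N..<N + m}. \<Sum>b\<in>{a..<2 * a}. \<kappa> / (real a)\<^sup>2)"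
      unfolding F_def by (subst sum.Sigma) (auto intro!: sum.cong)
    moreover have "\<dots> = (\<Sum>a\<in>{N..<N + m}. \<kappa> * inverse (real a))"
      by (intro sum.cong) (auto simp: power2_eq_square divide_simps)
    moreover have "\<dots> = \<kappa> * (\<Sum>i<m. inverse (real (i + N)))"
      unfolding sum_distrib_left[symmetric]
      using sum.shift_bounds_nat_ivl[of "\<lambda>a. inverse (real a)" 0 N m]
      by (simp add: add.commute atLeast0LessThan)
    ultimately show ?thesis using assms(1) by (simp add: field_simps)
  qed
  have "summable (\<lambda>i. inverse (real (i + N)))"
    by (rule summableI_nonneg_bounded[OF _ bound]) auto
  hence "summable (\<lambda>i. inverse (real i))" by (subst (asm) summable_iff_shift)
  thus False using not_summable_harmonic[where 'a = real] by simp
qed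

section \<open>Samples from a Cauchy distribution\<close>

locale cauchy_sample = prob_space M for M :: "'a measure" +
  fixes X :: "nat \<Rightarrow> 'a \<Rightarrow> real" and \<gamma> :: complex
  assumes Im_parameter_pos: "Im \<gamma> > 0"
    and indep: "indep_vars (\<lambda>_. borel) X {1..}"
    and distributed_cauchy: "j \<ge> 1 \<Longrightarrow> distributed M lborel (X j) (\<lambda>x. ennreal (cauchy_density \<gamma> x))"
begin

definition cauchy_law :: "real measure" where
  "cauchy_law = density lborel (\<lambda>x. ennreal (cauchy_density \<gamma> x))"

lemma sets_cauchy_law [simp, measurable_cong]: "sets cauchy_law = sets borel"
  by (simp add: cauchy_law_def)

lemma space_cauchy_law [simp]: "space cauchy_law = UNIV"
  by (simp add: cauchy_law_def)

lemma measurable_X: "j \<ge> 1 \<Longrightarrow> X j \<in> borel_measurable M"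
  using distributed_measurable[OF distributed_cauchy] by simp

lemma distr_X: "j \<ge> 1 \<Longrightarrow> distr M borel (X j) = cauchy_law"
  using distributed_distr_eq_density[OF distributed_cauchy, of j]
  by (simp add: cauchy_law_def cong: distr_cong)

lemma prob_space_cauchy_law: "prob_space cauchy_law"
  using prob_space_distr[OF measurable_X[of 1]] distr_X[of 1] by simp

lemma AE_cauchy_law_nonzero: "AE x in cauchy_law. complex_of_real x + \<alpha> \<noteq> 0"
proof -
  have "AE x in lborel. x \<noteq> - Re \<alpha>" by (rule AE_lborel_singleton)
  hence "AE x in lborel. ennreal (cauchy_density \<gamma> x) > 0 \<longrightarrow> complex_of_real x + \<alpha> \<noteq> 0"
    by eventually_elim (auto simp: complex_eq_iff)
  thus ?thesis unfolding cauchy_law_def by (subst AE_density) auto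
qed

lemma nn_integral_sample:
  assumes "finite I" "I \<noteq> {}" "I \<subseteq> {1..}" and g: "g \<in> borel_measurable (\<Pi>\<^sub>M j\<in>I. borel)"
  shows "(\<integral>\<^sup>+\<omega>. g (\<lambda>j\<in>I. X j \<omega>) \<partial>M) = (\<integral>\<^sup>+x. g x \<partial>(\<Pi>\<^sub>M j\<in>I. cauchy_law))"
proof -
  have rv: "X j \<in> borel_measurable M" if "j \<in> I" for j using that assms measurable_X by auto
  have "distr M (\<Pi>\<^sub>M j\<in>I. borel) (\<lambda>\<omega>. \<lambda>j\<in>I. X j \<omega>) = (\<Pi>\<^sub>M j\<in>I. distr M borel (X j))"
    using indep_vars_iff_distr_eq_PiM'[OF assms(2), where M' = "\<lambda>_. borel" and X = X] rv
      indep_vars_subset[OF indep assms(3)] by auto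
  also have "\<dots> = (\<Pi>\<^sub>M j\<in>I. cauchy_law)"
    using assms(3) by (intro PiM_cong distr_X) auto
  finally have "(\<integral>\<^sup>+x. g x \<partial>(\<Pi>\<^sub>M j\<in>I. cauchy_law))
      = (\<integral>\<^sup>+x. g x \<partial>distr M (\<Pi>\<^sub>M j\<in>I. borel) (\<lambda>\<omega>. \<lambda>j\<in>I. X j \<omega>))" by simp
  also have "\<dots> = (\<integral>\<^sup>+\<omega>. g (\<lambda>j\<in>I. X j \<omega>) \<partial>M)"
    using g rv by (intro nn_integral_distr measurable_restrict) auto
  finally show ?thesis ..
qed

text \<open>
  The integrand is at most the product of the \<open>|x j + \<alpha>|\<close> to the power \<open>2 / card J\<close>. Each factor
  has finite expectation because \<open>2 / card J < 1\<close>: this is where three observations are required.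
  The comparison can fail only where some \<open>x j + \<alpha>\<close> vanishes, a null set.
\<close>

lemma nn_integral_mean_powr_finite:
  assumes "finite J" "3 \<le> card J" "q > 0"
  shows "(\<integral>\<^sup>+x. ennreal ((\<Sum>j\<in>J. cmod (complex_of_real (x j) + \<alpha>) powr (-q)) powr (-2/q))
            \<partial>(\<Pi>\<^sub>M j\<in>J. cauchy_law)) < \<infinity>" (is "?I < \<infinity>")
proof -
  interpret L: prob_space cauchy_law by (rule prob_space_cauchy_law)
  interpret P: product_sigma_finite "\<lambda>_. cauchy_law" ..
  have J: "J \<noteq> {}" using assms by auto
  have "AE x in (\<Pi>\<^sub>M j\<in>J. cauchy_law). \<forall>j\<in>J. complex_of_real (x j) + \<alpha> \<noteq> 0"
    using assms(1)
    by (intro eventually_ball_finite ballI AE_PiM_component[where M = "\<lambda>_. cauchy_law"]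
        AE_cauchy_law_nonzero prob_space_cauchy_law)
  hence "?I \<le> (\<integral>\<^sup>+x. (\<Prod>j\<in>J. ennreal (cmod (complex_of_real (x j) + \<alpha>) powr (2 / card J)))
      \<partial>(\<Pi>\<^sub>M j\<in>J. cauchy_law))"
  proof (intro nn_integral_mono_AE, eventually_elim)
    case (elim x)
    have "(\<Sum>j\<in>J. cmod (complex_of_real (x j) + \<alpha>) powr (-q)) powr (-2/q)
        \<le> (\<Prod>j\<in>J. cmod (complex_of_real (x j) + \<alpha>) powr (2 / card J))"
      using elim assms J by (intro mean_powr_le_geometric) auto
    thus ?case by (subst prod_ennreal) (auto intro: ennreal_leI)
  qed
  also have "\<dots> = (\<Prod>j\<in>J. \<integral>\<^sup>+x. ennreal (cmod (complex_of_real x + \<alpha>) powr (2 / card J)) \<partial>cauchy_law)"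
    using assms(1) by (intro P.product_nn_integral_prod) auto
  also have "\<dots> < \<infinity>"
    using cauchy_moment_finite[OF Im_parameter_pos, of "2 / card J" \<alpha>] assms
    by (auto simp: cauchy_law_def less_top[symmetric] power_eq_top_ennreal)
  finally show ?thesis .
qed

section \<open>Finite second moments\<close>

text \<open>
  The sector bound compares the mean with the power mean of the norms \<open>|X j + \<alpha>|\<close>, for which the
  power sum above is integrable.
\<close>

lemma in_L2_power_mean:
  assumes "3 \<le> n" "-1 < p" "p < 0" "Im \<alpha> \<ge> 0"
  shows "in_L2 M (power_mean X p \<alpha> n)"
proof -
  define q where "q = -p"
  have q: "0 < q" "q < 1" "p = -q" using assms by (auto simp: q_def)
  define k where "k = cos (q * pi / 2) / n"
  have k: "k > 0" unfolding k_def using q assms by (intro divide_pos_pos cos_gt_zero) auto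
  let ?I = "{1..n}"
  define R where "R x = (\<Sum>j\<in>?I. cmod (complex_of_real (x j) + \<alpha>) powr (-q))" for x :: "nat \<Rightarrow> real"
  define g where "g x = ennreal (k powr (-2/q)) * ennreal (R x powr (-2/q))" for x
  have [measurable]: "R \<in> borel_measurable (\<Pi>\<^sub>M j\<in>?I. borel)" unfolding R_def by measurable
  have g: "g \<in> borel_measurable (\<Pi>\<^sub>M j\<in>?I. borel)" unfolding g_def by measurable
  have "(\<lambda>\<omega>. \<lambda>j\<in>?I. X j \<omega>) \<in> measurable M (\<Pi>\<^sub>M j\<in>?I. borel)"
    using measurable_X by (intro measurable_restrict) auto
  note meas = measurable_compose[OF this g]
  have "(\<integral>\<^sup>+\<omega>. g (\<lambda>j\<in>?I. X j \<omega>) \<partial>M) = (\<integral>\<^sup>+x. g x \<partial>(\<Pi>\<^sub>M j\<in>?I. cauchy_law))"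
    using assms g by (intro nn_integral_sample) auto
  also have "\<dots> = ennreal (k powr (-2/q)) * (\<integral>\<^sup>+x. ennreal (R x powr (-2/q)) \<partial>(\<Pi>\<^sub>M j\<in>?I. cauchy_law))"
    unfolding g_def by (intro nn_integral_cmult) measurable
  also have "\<dots> < \<infinity>"
    using nn_integral_mean_powr_finite[of ?I q \<alpha>] assms q by (auto simp: R_def ennreal_mult_less_top)
  finally have fin: "(\<integral>\<^sup>+\<omega>. g (\<lambda>j\<in>?I. X j \<omega>) \<partial>M) < \<infinity>" .
  have le: "ennreal ((cmod ((1 / of_nat n * (\<Sum>j=1..n. (complex_of_real (X j \<omega>) + \<alpha>) powr complex_of_real p))
       powr complex_of_real (1 / p)))\<^sup>2) \<le> g (\<lambda>j\<in>?I. X j \<omega>)" for \<omega>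
  proof -
    let ?z = "\<lambda>j. complex_of_real (X j \<omega>) + \<alpha>"
    let ?R = "\<Sum>j\<in>?I. cmod (?z j) powr (-q)"
    let ?S = "\<Sum>j=1..n. ?z j powr complex_of_real p"
    have "k * ?R \<le> cmod (1 / of_nat n * ?S)"
      using norm_sum_powr_ge[of ?I q ?z] assms q by (simp add: k_def norm_mult norm_divide divide_right_mono)
    moreover have "(cmod (w powr complex_of_real (1 / p)))\<^sup>2 = cmod w powr (-2/q)" for w
    proof -
      have "(cmod (w powr complex_of_real (1 / p)))\<^sup>2 = cmod w powr (1 / p + 1 / p)"
        by (simp only: powr_add power2_eq_square) (simp add: norm_powr_real_powr')
      thus ?thesis using q by (simp add: field_simps)
    qed
    moreover have "?R \<ge> 0" by (intro sum_nonneg) auto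
    \<comment> \<open>Powers of a negative exponent are decreasing for a positive base only, so
      \<open>R = 0\<close> is a separate case, in which both sides are \<open>0\<close>.\<close>
    moreover have "cmod (1 / of_nat n * ?S) = 0" if "?R = 0"
    proof -
      have "\<forall>j\<in>?I. cmod (?z j) powr (-q) = 0" using that by (subst (asm) sum_nonneg_eq_0_iff) auto
      thus ?thesis by (simp add: sum.neutral)
    qed
    ultimately have "(cmod ((1 / of_nat n * ?S) powr complex_of_real (1 / p)))\<^sup>2 \<le> (k * ?R) powr (-2/q)"
      using k q by (cases "?R = 0") (auto intro!: powr_mono2')
    also have "\<dots> = k powr (-2/q) * ?R powr (-2/q)" using k by (intro powr_mult)
    finally show ?thesis by (simp add: g_def R_def ennreal_mult[symmetric])
  qed
  show ?thesis
    using in_L2_diff_constI[OF meas fin le] unfolding power_mean_def .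
qed

lemma power_mean_minus_one:
  "power_mean X (-1) \<alpha> n \<omega> = of_nat n / (\<Sum>j=1..n. inverse (complex_of_real (X j \<omega>) + \<alpha>)) - \<alpha>"
proof -
  have "z powr complex_of_real (-1) = inverse z" for z by (simp add: powr_minus)
  thus ?thesis by (simp add: power_mean_def)
qed

text \<open>
  For \<open>p = -1\<close> the terms may cancel, but only in the real part: the imaginary parts of
  \<open>1/(x j + \<alpha>)\<close> are all negative. Integrating out one observation replaces the squared norm of
  the reciprocal sum by the imaginary part of the sum over the other \<open>n - 1 \<ge> 3\<close> observations,
  which is \<open>- Im \<alpha>\<close> times the sum of the \<open>|x j + \<alpha>|\<close> to the power \<open>-2\<close>; the reciprocal of that
  sum has finite expectation, as for \<open>q = 2\<close> above.
\<close>

lemma in_L2_harmonic_mean: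
  assumes "4 \<le> n" "Im \<alpha> > 0"
  shows "in_L2 M (power_mean X (-1) \<alpha> n)"
proof -
  interpret L: prob_space cauchy_law by (rule prob_space_cauchy_law)
  interpret P: product_sigma_finite "\<lambda>_. cauchy_law" ..
  let ?J = "{2..n}"
  have I: "{1..n} = insert 1 ?J" using assms by auto
  define W where "W J x = (\<Sum>j\<in>J. inverse (complex_of_real (x j) + \<alpha>))" for J and x :: "nat \<Rightarrow> real"
  define g where "g x = ennreal ((real n)\<^sup>2) * ennreal (1 / (cmod (W {1..n} x))\<^sup>2)" for x
  have W_meas [measurable]: "W J \<in> borel_measurable (\<Pi>\<^sub>M j\<in>J. borel)" for J unfolding W_def by measurable
  have g: "g \<in> borel_measurable (\<Pi>\<^sub>M j\<in>{1..n}. borel)" unfolding g_def by measurable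
  have "(\<lambda>\<omega>. \<lambda>j\<in>{1..n}. X j \<omega>) \<in> measurable M (\<Pi>\<^sub>M j\<in>{1..n}. borel)"
    using measurable_X by (intro measurable_restrict) auto
  note meas = measurable_compose[OF this g]
  obtain C where C: "C > 0" "\<And>w. Im w < 0 \<Longrightarrow>
     (\<integral>\<^sup>+x. ennreal (1 / (cmod (inverse (complex_of_real x + \<alpha>) + w))\<^sup>2) \<partial>cauchy_law) \<le> ennreal (C / (- Im w))"
    using cauchy_inverse_shift_bound[OF Im_parameter_pos assms(2)] unfolding cauchy_law_def by blast
  \<comment> \<open>The exponent is written as \<open>-2/2\<close> to match the power-sum bound at \<open>q = 2\<close>.\<close>
  let ?Q = "\<lambda>x. (\<Sum>j\<in>?J. cmod (complex_of_real (x j) + \<alpha>) powr (-2)) powr (-2/2)"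
  have inner: "(\<integral>\<^sup>+y. ennreal (1 / (cmod (W {1..n} (x(1 := y))))\<^sup>2) \<partial>cauchy_law)
      \<le> ennreal (C / Im \<alpha>) * ennreal (?Q x)" for x
  proof -
    have nz: "cmod (complex_of_real (x j) + \<alpha>) > 0" for j using assms by (auto simp: complex_eq_iff)
    let ?R = "\<Sum>j\<in>?J. cmod (complex_of_real (x j) + \<alpha>) powr (-2)"
    have R: "?R > 0" using assms nz by (intro sum_pos) auto
    have Im_inv: "Im (inverse z) = - Im z * cmod z powr (-2)" if "cmod z > 0" for z
      using that by (simp add: powr_minus cmod_power2 divide_inverse)
    have "Im (W ?J x) = (\<Sum>j\<in>?J. - Im \<alpha> * cmod (complex_of_real (x j) + \<alpha>) powr (-2))"
      using Im_inv[OF nz] by (simp add: W_def)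
    hence ImW: "Im (W ?J x) = - Im \<alpha> * ?R" by (simp add: sum_distrib_left)
    have "W {1..n} (x(1 := y)) = inverse (complex_of_real y + \<alpha>) + W ?J x" for y
      unfolding W_def I by (subst sum.insert) (auto intro!: sum.cong)
    hence "(\<integral>\<^sup>+y. ennreal (1 / (cmod (W {1..n} (x(1 := y))))\<^sup>2) \<partial>cauchy_law) \<le> ennreal (C / (- Im (W ?J x)))"
      using C(2)[of "W ?J x"] ImW R assms by simp
    also have "C / (- Im (W ?J x)) = C / Im \<alpha> * ?Q x"
      unfolding ImW using R assms by (simp add: powr_minus divide_simps)
    also have "ennreal \<dots> = ennreal (C / Im \<alpha>) * ennreal (?Q x)"
      using C assms by (intro ennreal_mult) auto
    finally show ?thesis .
  qed
  have "(\<lambda>x. ennreal (1 / (cmod (W {1..n} x))\<^sup>2)) \<in> borel_measurable (\<Pi>\<^sub>M j\<in>{1..n}. cauchy_law)"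
    by measurable
  hence "(\<integral>\<^sup>+x. ennreal (1 / (cmod (W {1..n} x))\<^sup>2) \<partial>(\<Pi>\<^sub>M j\<in>{1..n}. cauchy_law))
      = (\<integral>\<^sup>+x. \<integral>\<^sup>+y. ennreal (1 / (cmod (W {1..n} (x(1 := y))))\<^sup>2) \<partial>cauchy_law \<partial>(\<Pi>\<^sub>M j\<in>?J. cauchy_law))"
    unfolding I by (intro P.product_nn_integral_insert) auto
  also have "\<dots> \<le> (\<integral>\<^sup>+x. ennreal (C / Im \<alpha>) * ennreal (?Q x) \<partial>(\<Pi>\<^sub>M j\<in>?J. cauchy_law))"
    by (intro nn_integral_mono inner)
  also have "\<dots> = ennreal (C / Im \<alpha>) * (\<integral>\<^sup>+x. ennreal (?Q x) \<partial>(\<Pi>\<^sub>M j\<in>?J. cauchy_law))"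
    by (intro nn_integral_cmult) measurable
  finally have nested: "(\<integral>\<^sup>+x. ennreal (1 / (cmod (W {1..n} x))\<^sup>2) \<partial>(\<Pi>\<^sub>M j\<in>{1..n}. cauchy_law)) \<le> \<dots>" .
  have "(\<integral>\<^sup>+\<omega>. g (\<lambda>j\<in>{1..n}. X j \<omega>) \<partial>M) = (\<integral>\<^sup>+x. g x \<partial>(\<Pi>\<^sub>M j\<in>{1..n}. cauchy_law))"
    using assms g by (intro nn_integral_sample) auto
  also have "\<dots> = ennreal ((real n)\<^sup>2) * (\<integral>\<^sup>+x. ennreal (1 / (cmod (W {1..n} x))\<^sup>2) \<partial>(\<Pi>\<^sub>M j\<in>{1..n}. cauchy_law))"
    unfolding g_def by (intro nn_integral_cmult) measurable
  also have "\<dots> \<le> ennreal ((real n)\<^sup>2) * (ennreal (C / Im \<alpha>) * (\<integral>\<^sup>+x. ennreal (?Q x) \<partial>(\<Pi>\<^sub>M j\<in>?J. cauchy_law)))"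
    by (intro mult_left_mono nested) auto
  also have "\<dots> < \<infinity>"
    using nn_integral_mean_powr_finite[of ?J 2 \<alpha>] assms by (simp add: ennreal_mult_less_top)
  finally have fin: "(\<integral>\<^sup>+\<omega>. g (\<lambda>j\<in>{1..n}. X j \<omega>) \<partial>M) < \<infinity>" .
  have le: "ennreal ((cmod (of_nat n / (\<Sum>j=1..n. inverse (complex_of_real (X j \<omega>) + \<alpha>))))\<^sup>2)
      \<le> g (\<lambda>j\<in>{1..n}. X j \<omega>)" for \<omega>
    by (simp add: g_def W_def ennreal_mult[symmetric] norm_divide power_divide)
  show ?thesis
    using in_L2_diff_constI[OF meas fin le, of \<alpha>] unfolding power_mean_minus_one[abs_def] .
qed

end

section \<open>Infinite second moments\<close>

lemma norm_power_mean_two_ge: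
  assumes "0 < t" "t \<le> Re z" "t \<le> Re w" "-1 \<le> p" "p < 0"
  shows "t \<le> cmod ((1 / 2 * (z powr complex_of_real p + w powr complex_of_real p)) powr complex_of_real (1 / p))"
proof -
  have pos: "Re (z powr complex_of_real p) > 0" if "t \<le> Re z" for z
  proof -
    have "Re z > 0" using that assms by linarith
    hence z: "z \<noteq> 0" "\<bar>Im (Ln z)\<bar> < pi / 2" using Re_Ln_pos_lt_imp by auto
    \<comment> \<open>As \<open>|p| \<le> 1\<close>, the power stays in the open right half-plane, so two such powers cannot cancel.\<close>
    have "\<bar>p * Im (Ln z)\<bar> \<le> 1 * \<bar>Im (Ln z)\<bar>"
      unfolding abs_mult using assms by (intro mult_right_mono) auto
    hence "cos (p * Im (Ln z)) > 0" using z by (intro cos_gt_zero_pi) auto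
    thus ?thesis using z by (simp add: powr_def Re_exp)
  qed
  have le: "cmod (z powr complex_of_real p) \<le> t powr p" if "t \<le> Re z" for z
    using that assms complex_Re_le_cmod[of z] by (auto simp: norm_powr_real_powr' intro!: powr_mono2')
  let ?S = "1 / 2 * (z powr complex_of_real p + w powr complex_of_real p)"
  have "Re ?S > 0" using pos[of z] pos[of w] assms by simp
  hence S: "cmod ?S > 0" by (metis zero_less_norm_iff less_irrefl zero_complex.simps(1))
  have "cmod ?S \<le> t powr p"
    using norm_triangle_ineq[of "z powr complex_of_real p" "w powr complex_of_real p"] le[of z] le[of w] assms
    by (simp add: norm_mult norm_divide)
  hence "(t powr p) powr (1 / p) \<le> cmod ?S powr (1 / p)" using S assms by (intro powr_mono2') auto
  thus ?thesis using assms by (simp add: powr_powr norm_powr_real_powr')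
qed

text \<open>
  For given positive \<open>y1, y2\<close> the sum \<open>1/y1 + 1/y2 + 1/y3\<close> vanishes at
  \<open>y3 = - y1 y2 / (y1 + y2)\<close>, and since all three numbers are of the order of \<open>a\<close>, moving \<open>y3\<close>
  by a bounded amount changes the sum by \<open>O(1/a^2)\<close> only. As \<open>y1\<close> and \<open>y2\<close> run through unit
  intervals, that zero moves by at most one; so \<open>y3\<close> can be taken from a whole unit interval placed,
  by rounding up the largest value of \<open>y1 y2 / (y1 + y2)\<close>, just beyond all these zeros. This placement
  makes the sum strictly positive.
\<close>

lemma reciprocal_sum_bound:
  fixes a b y1 y2 y3 :: real and c :: int
  assumes "1 \<le> a" "a \<le> b" "b \<le> 2 * a"
    and y: "a \<le> y1" "y1 < a + 1" "b \<le> y2" "y2 < b + 1" "c < - y3" "- y3 \<le> c + 1"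
    and c: "c = \<lceil>(a + 1) * (b + 1) / (a + b + 2)\<rceil>"
  shows "0 < 1 / y1 + 1 / y2 + 1 / y3" "1 / y1 + 1 / y2 + 1 / y3 \<le> 28 / a\<^sup>2" "a / 2 \<le> - y3"
    "0 \<le> c" "c \<le> a + 2"
proof -
  define h where "h = (a + 1) * (b + 1) / (a + b + 2)"
  have h: "h * (a + b + 2) = (a + 1) * (b + 1)" using assms by (simp add: h_def)
  have ch: "h \<le> c" "c < h + 1" unfolding c h_def by linarith+
  \<comment> \<open>\<open>h\<close> is half a harmonic mean of \<open>a + 1\<close> and \<open>b + 1\<close>,
    hence lies between half the smaller one and the smaller one.\<close>
  have hlow: "a / 2 + 1 / 2 \<le> h"
  proof -
    have "(a + 1) / 2 * (a + b + 2) \<le> (a + 1) / 2 * (2 * (b + 1))"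
      using assms by (intro mult_left_mono) auto
    also have "\<dots> = (a + 1) * (b + 1)" by (simp add: field_simps)
    finally have "(a + 1) / 2 * (a + b + 2) \<le> (a + 1) * (b + 1)" .
    hence "(a + 1) / 2 \<le> h" using assms by (simp add: h_def pos_le_divide_eq)
    thus ?thesis by (simp add: add_divide_distrib)
  qed
  have hup: "h \<le> a + 1"
    using assms by (auto simp: h_def pos_divide_le_eq intro!: mult_left_mono)
  have "0 \<le> h" using hlow assms(1) by linarith
  hence "0 \<le> real_of_int c" using ch(1) by (rule order.trans)
  thus "0 \<le> c" by simp
  show "c \<le> a + 2" using hup ch(2) by linarith
  show y3: "a / 2 \<le> - y3" using hlow ch(1) y(5) by linarith
  define u where "u = - y3"
  have u: "h < u" "u < h + 2" "a / 2 \<le> u" "0 < u" using y y3 ch assms by (auto simp: u_def)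
  have pos: "0 < y1" "0 < y2" using assms by auto
  have eq: "1 / y1 + 1 / y2 + 1 / y3 = ((y1 + y2) * u - y1 * y2) / (y1 * y2 * u)"
    using pos u by (simp add: u_def field_simps)
  \<comment> \<open>Half the harmonic mean is increasing in both arguments, so \<open>h\<close> dominates \<open>y1 y2 / (y1 + y2)\<close>.\<close>
  have "y1 * y2 \<le> (y1 + y2) * h"
  proof -
    have "0 \<le> y1 * (a + 1) * ((b + 1) - y2) + y2 * (b + 1) * ((a + 1) - y1)"
      using assms pos by (intro add_nonneg_nonneg mult_nonneg_nonneg) auto
    hence "y1 * y2 * (a + b + 2) \<le> (y1 + y2) * ((a + 1) * (b + 1))" by (simp add: algebra_simps)
    thus ?thesis using assms by (simp add: h_def pos_le_divide_eq)
  qed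
  also have "\<dots> < (y1 + y2) * u" using u pos by (intro mult_strict_left_mono) auto
  finally have num: "0 < (y1 + y2) * u - y1 * y2" by simp
  thus "0 < 1 / y1 + 1 / y2 + 1 / y3" unfolding eq using pos u by (intro divide_pos_pos mult_pos_pos) auto
  have "(y1 + y2) * u \<le> (a + b + 2) * (h + 2)" using y u pos by (intro mult_mono) auto
  moreover have "a * b \<le> y1 * y2" using assms by (intro mult_mono) auto
  ultimately have "(y1 + y2) * u - y1 * y2 \<le> (a + b + 2) * (h + 2) - a * b" by linarith
  also have "\<dots> = 3 * a + 3 * b + 5" using h by (simp add: algebra_simps)
  also have "\<dots> \<le> 14 * a" using assms by linarith
  finally have num': "(y1 + y2) * u - y1 * y2 \<le> 14 * a" .
  have "a * a * (a / 2) \<le> y1 * y2 * u" using assms u by (intro mult_mono) auto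
  hence "((y1 + y2) * u - y1 * y2) / (y1 * y2 * u) \<le> 14 * a / (a * a * (a / 2))"
    using num num' assms by (intro frac_le) auto
  also have "\<dots> = 28 / a\<^sup>2" using assms by (simp add: power2_eq_square)
  finally show "1 / y1 + 1 / y2 + 1 / y3 \<le> 28 / a\<^sup>2" unfolding eq .
qed

lemma norm_inverse_shift_diff_le:
  assumes "y \<noteq> 0" "0 \<le> \<beta>"
  shows "cmod (inverse (Complex y \<beta>) - complex_of_real (1 / y)) \<le> \<beta> / y\<^sup>2"
proof -
  have nz: "Complex y \<beta> \<noteq> 0" using assms by (auto simp: complex_eq_iff)
  have "inverse (Complex y \<beta>) - complex_of_real (1 / y)
      = (complex_of_real y - Complex y \<beta>) / (complex_of_real y * Complex y \<beta>)"
    using nz assms by (simp add: divide_simps)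
  also have "complex_of_real y - Complex y \<beta> = Complex 0 (-\<beta>)" by (simp add: complex_eq_iff)
  finally have "cmod (inverse (Complex y \<beta>) - complex_of_real (1 / y)) = \<beta> / (\<bar>y\<bar> * cmod (Complex y \<beta>))"
    using assms by (simp add: norm_divide norm_mult complex_norm)
  also have "\<dots> \<le> \<beta> / (\<bar>y\<bar> * \<bar>y\<bar>)"
    using assms nz abs_Re_le_cmod[of "Complex y \<beta>"]
    by (intro divide_left_mono mult_left_mono mult_pos_pos) auto
  finally show ?thesis by (simp add: power2_eq_square)
qed

text \<open>
  A nonnegative imaginary part \<open>\<beta>\<close> perturbs each reciprocal by \<open>O(\<beta>/a^2)\<close>, the same order as the
  bound for the real sum. That \<open>W\<close> is not \<open>0\<close> matters because the power mean takes the value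
  \<open>- \<alpha>\<close> there instead of a large one; it follows from the positivity of the real sum if \<open>\<beta> = 0\<close> and
  from \<open>Im W < 0\<close> otherwise.
\<close>

lemma inverse_sum_three_bound:
  assumes "1 \<le> a" "a / 2 \<le> \<bar>y1\<bar>" "a / 2 \<le> \<bar>y2\<bar>" "a / 2 \<le> \<bar>y3\<bar>" "0 \<le> \<beta>"
    and s: "0 < 1 / y1 + 1 / y2 + 1 / y3" "1 / y1 + 1 / y2 + 1 / y3 \<le> 28 / a\<^sup>2"
  defines "W \<equiv> inverse (Complex y1 \<beta>) + inverse (Complex y2 \<beta>) + inverse (Complex y3 \<beta>)"
  shows "W \<noteq> 0" "cmod W \<le> (28 + 12 * \<beta>) / a\<^sup>2"
proof -
  have nz: "y1 \<noteq> 0" "y2 \<noteq> 0" "y3 \<noteq> 0" using assms by auto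
  let ?s = "1 / y1 + 1 / y2 + 1 / y3"
  let ?d = "\<lambda>y. inverse (Complex y \<beta>) - complex_of_real (1 / y)"
  have d: "cmod (?d y) \<le> 4 * \<beta> / a\<^sup>2" if "a / 2 \<le> \<bar>y\<bar>" for y
  proof -
    have y: "y \<noteq> 0" using that assms by auto
    have "(a / 2)\<^sup>2 \<le> \<bar>y\<bar>\<^sup>2" using that assms by (intro power_mono) auto
    hence "\<beta> / y\<^sup>2 \<le> \<beta> / (a / 2)\<^sup>2" using assms y by (intro divide_left_mono) auto
    thus ?thesis using norm_inverse_shift_diff_le[OF y assms(5)] by (simp add: power2_eq_square field_simps)
  qed
  have W: "W = complex_of_real ?s + (?d y1 + (?d y2 + ?d y3))" unfolding W_def by (simp add: algebra_simps)
  have "cmod W \<le> cmod (complex_of_real ?s) + (cmod (?d y1) + (cmod (?d y2) + cmod (?d y3)))"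
    unfolding W by (intro order.trans[OF norm_triangle_ineq] add_left_mono order.refl)
  also have "\<dots> \<le> 28 / a\<^sup>2 + (4 * \<beta> / a\<^sup>2 + (4 * \<beta> / a\<^sup>2 + 4 * \<beta> / a\<^sup>2))"
    using s d assms by (intro add_mono) (auto simp: norm_of_real simp del: of_real_add)
  also have "\<dots> = (28 + 12 * \<beta>) / a\<^sup>2" by (simp add: add_divide_distrib)
  finally show "cmod W \<le> (28 + 12 * \<beta>) / a\<^sup>2" .
  show "W \<noteq> 0"
  proof (cases "\<beta> = 0")
    case True
    have "W = complex_of_real ?s"
      by (simp add: W_def True complex_of_real_def[symmetric] inverse_eq_divide)
    thus ?thesis using s by (simp only: of_real_eq_0_iff)
  next
    case False
    hence "\<beta> > 0" using assms by simp
    hence neg: "Im (inverse (Complex y \<beta>)) < 0" for y by (simp add: divide_neg_pos add_nonneg_pos)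
    have "Im W < 0"
      unfolding W_def plus_complex.sel using neg[of y1] neg[of y2] neg[of y3] by linarith
    thus ?thesis by auto
  qed
qed

context cauchy_sample
begin

lemma prob_box_ge:
  "\<exists>c>0. \<forall>J k. finite J \<longrightarrow> J \<noteq> {} \<longrightarrow> J \<subseteq> {1..} \<longrightarrow>
     (\<Prod>j\<in>J. c / (1 + (real_of_int (k j))\<^sup>2)) \<le> prob {\<omega>\<in>space M. \<forall>j\<in>J. \<lfloor>X j \<omega> + r\<rfloor> = k j}"
proof -
  obtain c where c: "c > 0" "\<And>k x. \<lfloor>x + r\<rfloor> = k \<Longrightarrow> c / (1 + (real_of_int k)\<^sup>2) \<le> cauchy_density \<gamma> x"
    using cauchy_density_lower_bound[OF Im_parameter_pos, of r] by auto
  have one: "c / (1 + (real_of_int k)\<^sup>2) \<le> prob (X j -` {x. \<lfloor>x + r\<rfloor> = k} \<inter> space M)" if "j \<ge> 1" for j k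
  proof -
    have iv: "{x. \<lfloor>x + r\<rfloor> = k} = {real_of_int k - r..<real_of_int k - r + 1}"
      by (auto simp: floor_eq_iff)
    have "ennreal (c / (1 + (real_of_int k)\<^sup>2))
        = (\<integral>\<^sup>+x. ennreal (c / (1 + (real_of_int k)\<^sup>2)) * indicator {x. \<lfloor>x + r\<rfloor> = k} x \<partial>lborel)"
      unfolding iv by (subst nn_integral_cmult_indicator) auto
    also have "\<dots> \<le> (\<integral>\<^sup>+x. ennreal (cauchy_density \<gamma> x) * indicator {x. \<lfloor>x + r\<rfloor> = k} x \<partial>lborel)"
      using c by (intro nn_integral_mono) (auto split: split_indicator intro!: ennreal_leI)
    also have "\<dots> = emeasure (distr M borel (X j)) {x. \<lfloor>x + r\<rfloor> = k}"
      unfolding distr_X[OF that] cauchy_law_def by (subst emeasure_density) (auto simp: iv)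
    also have "\<dots> = ennreal (prob (X j -` {x. \<lfloor>x + r\<rfloor> = k} \<inter> space M))"
      using measurable_X[OF that] by (subst emeasure_distr) (auto simp: iv emeasure_eq_measure)
    finally show ?thesis by (simp add: ennreal_le_iff)
  qed
  have "(\<Prod>j\<in>J. c / (1 + (real_of_int (k j))\<^sup>2)) \<le> prob {\<omega>\<in>space M. \<forall>j\<in>J. \<lfloor>X j \<omega> + r\<rfloor> = k j}"
    if J: "finite J" "J \<noteq> {}" "J \<subseteq> {1..}" for J k
  proof -
    have "(\<Prod>j\<in>J. c / (1 + (real_of_int (k j))\<^sup>2)) \<le> (\<Prod>j\<in>J. prob (X j -` {x. \<lfloor>x + r\<rfloor> = k j} \<inter> space M))"
      using one J c by (intro prod_mono) (auto simp: subset_eq intro!: divide_nonneg_nonneg)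
    also have "\<dots> = prob (\<Inter>j\<in>J. X j -` {x. \<lfloor>x + r\<rfloor> = k j} \<inter> space M)"
      by (intro indep_varsD[OF indep J(2,1,3), symmetric]) measurable
    also have "(\<Inter>j\<in>J. X j -` {x. \<lfloor>x + r\<rfloor> = k j} \<inter> space M) = {\<omega>\<in>space M. \<forall>j\<in>J. \<lfloor>X j \<omega> + r\<rfloor> = k j}"
      using J by auto
    finally show ?thesis .
  qed
  thus ?thesis using c(1) by blast
qed

text \<open>
  If both shifted observations are at least \<open>a\<close>, then so is the norm of the mean plus \<open>\<alpha>\<close>. A box
  at \<open>(a, b)\<close> with \<open>b < 2 a\<close> has probability of order \<open>1/a^4\<close> and the squared mean is at
  least of order \<open>a^2\<close> there, which is the balance required for divergence.
\<close>

lemma not_in_L2_power_mean_two: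
  assumes "-1 \<le> p" "p < 0"
  shows "\<not> in_L2 M (power_mean X p \<alpha> 2)"
proof -
  define r where "r = Re \<alpha>"
  obtain c where c: "c > 0" "\<And>J k. finite J \<Longrightarrow> J \<noteq> {} \<Longrightarrow> J \<subseteq> {1..} \<Longrightarrow>
     (\<Prod>j\<in>J. c / (1 + (real_of_int (k j))\<^sup>2)) \<le> prob {\<omega>\<in>space M. \<forall>j\<in>J. \<lfloor>X j \<omega> + r\<rfloor> = k j}"
    using prob_box_ge[of r] by blast
  define k where "k a b j = (if j = 1 then int a else int b)" for a b j :: nat
  define E where "E a b = {\<omega>\<in>space M. \<forall>j\<in>{1,2}. \<lfloor>X j \<omega> + r\<rfloor> = k a b j}" for a b
  \<comment> \<open>From \<open>N\<close> on, subtracting \<open>\<alpha>\<close> costs at most half of the lower bound \<open>a\<close>.\<close>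
  define N where "N = nat \<lceil>2 * cmod \<alpha>\<rceil> + 1"
  have N: "1 \<le> real a" "2 * cmod \<alpha> \<le> real a" if "N \<le> a" for a using that unfolding N_def by linarith+
  have [measurable]: "X (Suc 0) \<in> borel_measurable M" "X 2 \<in> borel_measurable M"
    by (auto intro: measurable_X)
  show ?thesis
  proof (rule not_in_L2_if_dyadic_boxes[where E = E and v = "\<lambda>a. (real a / 2)\<^sup>2" and N = N and \<kappa> = "c\<^sup>2 / 40"])
    show "c\<^sup>2 / 40 > 0" using c by simp
    show "E a b \<in> events" for a b by (simp add: E_def) measurable
    show "a = a' \<and> b = b'" if "\<omega> \<in> E a b" "\<omega> \<in> E a' b'" for a b a' b' \<omega>
      using that by (auto simp: E_def k_def)
    fix a b assume ab: "N \<le> a" "a \<le> b" "b < 2 * a"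
    note a = N[OF ab(1)]
    {
      fix \<omega> assume "\<omega> \<in> E a b"
      hence "\<lfloor>X 1 \<omega> + r\<rfloor> = int a" "\<lfloor>X 2 \<omega> + r\<rfloor> = int b" by (auto simp: E_def k_def)
      hence "real a \<le> X 1 \<omega> + r" "real a \<le> X 2 \<omega> + r" using ab by linarith+
      hence "real a \<le> cmod (power_mean X p \<alpha> 2 \<omega> + \<alpha>)"
        using norm_power_mean_two_ge[of "real a" "complex_of_real (X 1 \<omega>) + \<alpha>" "complex_of_real (X 2 \<omega>) + \<alpha>" p] a assms
        by (simp add: power_mean_def r_def numeral_2_eq_2)
      hence "real a / 2 \<le> cmod (power_mean X p \<alpha> 2 \<omega>)"
        using norm_triangle_ineq[of "power_mean X p \<alpha> 2 \<omega>" \<alpha>] a by linarith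
      thus "(real a / 2)\<^sup>2 \<le> (cmod (power_mean X p \<alpha> 2 \<omega>))\<^sup>2" by (intro power_mono) auto
    }
    have A: "1 + (real a)\<^sup>2 \<le> 2 * (real a)\<^sup>2" using a by simp
    have "(real b)\<^sup>2 \<le> (2 * real a)\<^sup>2" using ab by (intro power_mono) auto
    hence B: "1 + (real b)\<^sup>2 \<le> 5 * (real a)\<^sup>2" using A by (simp add: power_mult_distrib)
    have "c / (2 * (real a)\<^sup>2) * (c / (5 * (real a)\<^sup>2)) \<le> c / (1 + (real a)\<^sup>2) * (c / (1 + (real b)\<^sup>2))"
      using A B c a by (intro mult_mono divide_left_mono) (auto intro!: mult_pos_pos add_pos_nonneg)
    also have "\<dots> \<le> prob (E a b)"
      using c(2)[of "{1,2}" "k a b"] by (simp add: E_def k_def)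
    finally have "(real a / 2)\<^sup>2 * (c / (2 * (real a)\<^sup>2) * (c / (5 * (real a)\<^sup>2))) \<le> (real a / 2)\<^sup>2 * prob (E a b)"
      by (intro mult_left_mono) auto
    thus "c\<^sup>2 / 40 / (real a)\<^sup>2 \<le> (real a / 2)\<^sup>2 * prob (E a b)"
      using a by (simp add: power2_eq_square)
  qed auto
qed

text \<open>
  Choosing the third coordinate in the unit interval that nearly cancels the reciprocals of the first
  two makes the mean at least of order \<open>a^2\<close>, on a box of probability of order \<open>1/a^6\<close>. Again the
  product of the squared mean and the probability is at least of order \<open>1/a^2\<close>.
\<close>

lemma not_in_L2_harmonic_mean_three:
  assumes "Im \<alpha> \<ge> 0"
  shows "\<not> in_L2 M (power_mean X (-1) \<alpha> 3)"
proof -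
  define r \<beta> where "r = Re \<alpha>" and "\<beta> = Im \<alpha>"
  define D where "D = 28 + 12 * \<beta>"
  have D: "D > 0" using assms by (simp add: D_def \<beta>_def)
  obtain c where c: "c > 0" "\<And>J k. finite J \<Longrightarrow> J \<noteq> {} \<Longrightarrow> J \<subseteq> {1..} \<Longrightarrow>
     (\<Prod>j\<in>J. c / (1 + (real_of_int (k j))\<^sup>2)) \<le> prob {\<omega>\<in>space M. \<forall>j\<in>J. \<lfloor>X j \<omega> + r\<rfloor> = k j}"
    using prob_box_ge[of r] by blast
  \<comment> \<open>The third coordinate has floor \<open>- m - 1\<close>: it lies in \<open>[- m - 1, - m)\<close>, which is strictly beyond the zero.\<close>
  define m where "m a b = \<lceil>(real a + 1) * (real b + 1) / (real a + real b + 2)\<rceil>" for a b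
  define k where "k a b j = (if j = 1 then int a else if j = 2 then int b else - m a b - 1)" for a b j :: nat
  define E where "E a b = {\<omega>\<in>space M. \<forall>j\<in>{1,2,3}. \<lfloor>X j \<omega> + r\<rfloor> = k a b j}" for a b
  \<comment> \<open>From \<open>N\<close> on, subtracting \<open>\<alpha>\<close> costs at most a third of the lower bound \<open>3 a^2 / D\<close>.\<close>
  define N where "N = nat \<lceil>cmod \<alpha> * D\<rceil> + 1"
  have N: "1 \<le> real a" "cmod \<alpha> * D \<le> real a" if "N \<le> a" for a using that unfolding N_def by linarith+
  define v where "v a = (2 * (real a)\<^sup>2 / D)\<^sup>2" for a :: nat
  have [measurable]: "X (Suc 0) \<in> borel_measurable M" "X 2 \<in> borel_measurable M" "X 3 \<in> borel_measurable M"
    by (auto intro: measurable_X)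
  show ?thesis
  proof (rule not_in_L2_if_dyadic_boxes[where E = E and v = v and N = N and \<kappa> = "4 * c ^ 3 / (170 * D\<^sup>2)"])
    show "4 * c ^ 3 / (170 * D\<^sup>2) > 0" using c D by simp
    show "E a b \<in> events" for a b by (simp add: E_def) measurable
    show "v a \<ge> 0" for a by (simp add: v_def)
    show "a = a' \<and> b = b'" if "\<omega> \<in> E a b" "\<omega> \<in> E a' b'" for a b a' b' \<omega>
      using that by (auto simp: E_def k_def)
    fix a b assume ab: "N \<le> a" "a \<le> b" "b < 2 * a"
    note a = N[OF ab(1)]
    have ab': "1 \<le> real a" "real a \<le> real b" "real b \<le> 2 * real a" using ab a by linarith+
    {
      fix \<omega> assume \<omega>: "\<omega> \<in> E a b"
      define y where "y j = X j \<omega> + r" for j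
      have "\<lfloor>y 1\<rfloor> = int a" "\<lfloor>y 2\<rfloor> = int b" "\<lfloor>y 3\<rfloor> = - m a b - 1" using \<omega> by (auto simp: E_def k_def y_def)
      hence y: "real a \<le> y 1" "y 1 < real a + 1" "real b \<le> y 2" "y 2 < real b + 1"
        "m a b < - y 3" "- y 3 \<le> m a b + 1" by linarith+
      note s = reciprocal_sum_bound[OF ab' y m_def]
      define W where "W = inverse (Complex (y 1) \<beta>) + inverse (Complex (y 2) \<beta>) + inverse (Complex (y 3) \<beta>)"
      have "W \<noteq> 0" "cmod W \<le> D / (real a)\<^sup>2"
        unfolding W_def D_def using s y ab' assms
        by (intro inverse_sum_three_bound; simp add: \<beta>_def)+
      hence "(real a)\<^sup>2 / D \<le> 1 / cmod W" using D a by (simp add: field_simps)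
      moreover have "power_mean X (-1) \<alpha> 3 \<omega> + \<alpha> = 3 / W"
      proof -
        have "complex_of_real (X j \<omega>) + \<alpha> = Complex (y j) \<beta>" for j
          by (simp add: complex_eq_iff y_def r_def \<beta>_def)
        thus ?thesis by (simp add: power_mean_minus_one W_def numeral_3_eq_3 numeral_2_eq_2)
      qed
      ultimately have "3 * (real a)\<^sup>2 / D \<le> cmod (power_mean X (-1) \<alpha> 3 \<omega> + \<alpha>)"
        by (simp add: norm_divide)
      moreover have "cmod \<alpha> \<le> (real a)\<^sup>2 / D"
      proof -
        have "cmod \<alpha> * D \<le> (real a)\<^sup>2" using a self_le_power[of "real a" 2] by linarith
        thus ?thesis using D by (simp add: pos_le_divide_eq)
      qed
      moreover have "3 * (real a)\<^sup>2 / D = 2 * (real a)\<^sup>2 / D + (real a)\<^sup>2 / D" using D by (simp add: field_simps)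
      ultimately have "2 * (real a)\<^sup>2 / D \<le> cmod (power_mean X (-1) \<alpha> 3 \<omega>)"
        using norm_triangle_ineq[of "power_mean X (-1) \<alpha> 3 \<omega>" \<alpha>] by linarith
      thus "v a \<le> (cmod (power_mean X (-1) \<alpha> 3 \<omega>))\<^sup>2" unfolding v_def using D by (intro power_mono) auto
    }
    have A: "1 + (real a)\<^sup>2 \<le> 2 * (real a)\<^sup>2" using a by simp
    have "(real b)\<^sup>2 \<le> (2 * real a)\<^sup>2" using ab by (intro power_mono) auto
    hence B: "1 + (real b)\<^sup>2 \<le> 5 * (real a)\<^sup>2" using A by (simp add: power_mult_distrib)
    have m: "0 \<le> m a b" "m a b \<le> real a + 2"
      using reciprocal_sum_bound(4,5)[OF ab', of "real a" "real b" "m a b" "- m a b - 1"] m_def by auto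
    have "(- real_of_int (m a b) - 1)\<^sup>2 = (real_of_int (m a b) + 1)\<^sup>2" by (simp add: power2_eq_square algebra_simps)
    also have "\<dots> \<le> (4 * real a)\<^sup>2" using m a by (intro power_mono) auto
    finally have C: "1 + (- real_of_int (m a b) - 1)\<^sup>2 \<le> 17 * (real a)\<^sup>2" using A by (simp add: power_mult_distrib)
    have "c / (2 * (real a)\<^sup>2) * (c / (5 * (real a)\<^sup>2) * (c / (17 * (real a)\<^sup>2)))
       \<le> c / (1 + (real a)\<^sup>2) * (c / (1 + (real b)\<^sup>2) * (c / (1 + (- real_of_int (m a b) - 1)\<^sup>2)))"
      using A B C c a by (intro mult_mono divide_left_mono) (auto intro!: mult_pos_pos add_pos_nonneg)
    also have "\<dots> \<le> prob (E a b)"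
      using c(2)[of "{1,2,3}" "k a b"] by (simp add: E_def k_def)
    finally have "v a * (c / (2 * (real a)\<^sup>2) * (c / (5 * (real a)\<^sup>2) * (c / (17 * (real a)\<^sup>2)))) \<le> v a * prob (E a b)"
      by (intro mult_left_mono) (auto simp: v_def)
    thus "4 * c ^ 3 / (170 * D\<^sup>2) / (real a)\<^sup>2 \<le> v a * prob (E a b)"
      using a D by (simp add: v_def power2_eq_square power3_eq_cube)
  qed
qed

end

theorem theorem7p2:
  fixes M :: "'a measure" and X :: "nat \<Rightarrow> 'a \<Rightarrow> real" and \<gamma> :: complex
  assumes "prob_space M"
    and "Im \<gamma> > 0"
    and "prob_space.indep_vars M (\<lambda>_. borel) X {1..}"
    and "\<And>j. j \<ge> 1 \<Longrightarrow> distributed M lborel (X j) (\<lambda>x. ennreal (cauchy_density \<gamma> x))"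
  shows "(\<forall>(p::real) (\<alpha>::complex). -1 \<le> p \<and> p < 0 \<and> Im \<alpha> \<ge> 0
            \<longrightarrow> \<not> in_L2 M (power_mean X p \<alpha> 2))
       \<and> (\<forall>\<alpha>::complex. Im \<alpha> \<ge> 0 \<longrightarrow> \<not> in_L2 M (power_mean X (-1) \<alpha> 3))
       \<and> (\<forall>(n::nat) (p::real) (\<alpha>::complex). n \<ge> 3 \<and> -1 < p \<and> p < 0 \<and> Im \<alpha> \<ge> 0
            \<longrightarrow> in_L2 M (power_mean X p \<alpha> n))
       \<and> (\<forall>(n::nat) (\<alpha>::complex). n \<ge> 4 \<and> Im \<alpha> > 0
            \<longrightarrow> in_L2 M (power_mean X (-1) \<alpha> n))"
proof -
  interpret prob_space M by fact
  interpret cauchy_sample M X \<gamma> using assms by unfold_locales auto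
  show ?thesis
    using not_in_L2_power_mean_two not_in_L2_harmonic_mean_three in_L2_power_mean in_L2_harmonic_mean
    by blast
qed

end
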